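(* Let $\mathbb K$ be a field. (1) There is a homogeneous potential $F\in\mathbb K\langle x,y\rangle$ of degree $4$ such that the potential algebra $A_F$ has polynomial growth (at least quadratic). (2) For every homogeneous potential $F\in\mathbb K\langle x,y\rangle$ of degree at least $5$, the potential algebra $A_F$ has exponential growth.
   Context: $\mathbb K\langle x,y\rangle$ is the free associative unital algebra on $x,y$, with $\deg x=\deg y=1$. A polynomial $F\in\mathbb K\langle x,y\rangle$ is cyclicly invariant if it is fixed by the linear map sending each monomial $zu$ ($z\in\{x,y\}$, $u$ a monomial) to $uz$ and fixing constants. The linear maps $\partial_x,\partial_y:\mathbb K\langle x,y\rangle\to\mathbb K\langle x,y\rangle$ are defined on monomials by $\partial_x w=u$ if $w=xu$ and $\partial_x w=0$ otherwise; $\partial_y w=u$ if $w=yu$ and $\partial_y w=0$ otherwise. A potential is a cyclicly invariant polynomial $F$, and its potential algebra is $A_F=\mathbb K\langle x,y\rangle/I_F$, where $I_F$ is the two-sided ideal generated by $\partial_xF$ and $\partial_yF$. For homogeneous $F$ the algebra $A=A_F=\bigoplus_{j\ge0}A_j$ is graded; its growth is that of the function $g(m)=\sum_{j\le m}\dim_{\mathbb K}A_j$. Growth is polynomial if $g(m)\le C m^k$ for some constants $C,k$ and all $m\ge1$; at least quadratic if $g(m)\ge c\,m^2$ for some $c>0$ and all $m\geq 1$; exponential if $g(m)\ge c\,q^m$ for some $c>0$, $q>1$ and all $m\ge 1$. *)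

theory Defs
  imports
    "HOL-Library.Poly_Mapping"
    "HOL-Algebra.Embedded_Algebras"
    "HOL-Algebra.QuotRing"
    "HOL-Algebra.Algebraic_Closure_Type"
begin

text \<open>
  Words over an alphabet form the free monoid, written additively because the convolution product
  on \<^typ>\<open>'a \<Rightarrow>\<^sub>0 'b\<close> is indexed by the class \<^class>\<open>monoid_add\<close>. (This instance clashes with the
  pointwise addition of lists in HOL-Library.ListVector.)
\<close>

instantiation list :: (type) monoid_add
begin

definition zero_list :: "'a list" where "0 = []"

definition plus_list :: "'a list \<Rightarrow> 'a list \<Rightarrow> 'a list" where "u + v = u @ v"

instance
  by intro_classes (simp_all add: zero_list_def plus_list_def)

end

datatype letter = Lx | Ly

text \<open>
  The monoid algebra of the free monoid is the free associative algebra on two letters; its ring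
  structure is the \<^class>\<open>ring_1\<close> instance provided by \<^theory>\<open>HOL-Library.Poly_Mapping\<close>.
\<close>

type_synonym 'k freealg = "letter list \<Rightarrow>\<^sub>0 'k"

abbreviation monomial :: "letter list \<Rightarrow> 'k::field freealg"
  where "monomial w \<equiv> Poly_Mapping.single w 1"

definition scalar :: "'k::field \<Rightarrow> 'k freealg"
  where "scalar c = Poly_Mapping.single [] c"

definition linear_ext :: "(letter list \<Rightarrow> 'k freealg) \<Rightarrow> 'k::field freealg \<Rightarrow> 'k freealg"
  where "linear_ext \<phi> F = (\<Sum>w\<in>Poly_Mapping.keys F. scalar (Poly_Mapping.lookup F w) * \<phi> w)"

definition cyclic_shift :: "'k::field freealg \<Rightarrow> 'k freealg"
  where "cyclic_shift =
    linear_ext (\<lambda>w. case w of [] \<Rightarrow> monomial [] | z # u \<Rightarrow> monomial (u @ [z]))"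

definition potential :: "'k::field freealg \<Rightarrow> bool"
  where "potential F \<longleftrightarrow> cyclic_shift F = F"

definition pderivative :: "letter \<Rightarrow> 'k::field freealg \<Rightarrow> 'k freealg"
  where "pderivative z =
    linear_ext (\<lambda>w. case w of [] \<Rightarrow> 0 | z' # u \<Rightarrow> if z' = z then monomial u else 0)"

text \<open>As usual for graded components, this contains \<open>0\<close> for every \<open>n\<close>.\<close>

definition homogeneous :: "nat \<Rightarrow> 'k::field freealg set"
  where "homogeneous n = {F. \<forall>w\<in>Poly_Mapping.keys F. length w = n}"

abbreviation free_ring :: "'k::field freealg ring"
  where "free_ring \<equiv> ring_of_type_algebra"

definition potential_ideal :: "'k::field freealg \<Rightarrow> 'k freealg set"
  where "potential_ideal F = Idl\<^bsub>free_ring\<^esub> {pderivative Lx F, pderivative Ly F}"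

definition potential_algebra :: "'k::field freealg \<Rightarrow> 'k freealg set ring"
  where "potential_algebra F = free_ring Quot (potential_ideal F)"

definition quotient_map :: "'k::field freealg \<Rightarrow> 'k freealg \<Rightarrow> 'k freealg set"
  where "quotient_map F p = potential_ideal F +>\<^bsub>free_ring\<^esub> p"

definition component :: "'k::field freealg \<Rightarrow> nat \<Rightarrow> 'k freealg set set"
  where "component F j = quotient_map F ` homogeneous j"

text \<open>
  The ground field enters \<^const>\<open>ring.dim\<close> as the image of the scalars in the quotient. It is a
  subfield there as soon as the ideal is proper, in particular when \<open>F\<close> is homogeneous of
  degree at least 2.
\<close>

definition component_dim :: "'k::field freealg \<Rightarrow> nat \<Rightarrow> nat"
  where "component_dim F j =
    ring.dim (potential_algebra F) (quotient_map F ` range scalar) (component F j)"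

definition growth :: "'k::field freealg \<Rightarrow> nat \<Rightarrow> nat"
  where "growth F m = (\<Sum>j\<le>m. component_dim F j)"

definition polynomial_growth :: "(nat \<Rightarrow> nat) \<Rightarrow> bool"
  where "polynomial_growth g \<longleftrightarrow>
    (\<exists>(C::real) (k::nat). \<forall>m\<ge>1. real (g m) \<le> C * real m ^ k)"

definition at_least_quadratic_growth :: "(nat \<Rightarrow> nat) \<Rightarrow> bool"
  where "at_least_quadratic_growth g \<longleftrightarrow>
    (\<exists>c::real. c > 0 \<and> (\<forall>m\<ge>1. real (g m) \<ge> c * real m ^ 2))"

definition exponential_growth :: "(nat \<Rightarrow> nat) \<Rightarrow> bool"
  where "exponential_growth g \<longleftrightarrow>
    (\<exists>(c::real) (q::real). c > 0 \<and> q > 1 \<and> (\<forall>m\<ge>1. real (g m) \<ge> c * q ^ m))"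

end

theory Submission
  imports Defs
begin

text \<open>
  Write \<open>R\<close> for the free algebra, \<open>I\<close> for the ideal of a homogeneous potential \<open>F\<close> of degree \<open>n\<close>,
  \<open>f\<close> and \<open>g\<close> for the derivatives of \<open>F\<close> by \<open>x\<close> and \<open>y\<close>, which are homogeneous of degree \<open>d = n - 1\<close>,
  and \<open>a\<^sub>j\<close> for the dimension of the component of degree \<open>j\<close> of \<open>R / I\<close>.

  \<^bold>\<open>Degree at least 5.\<close> The argument refines the one of Golod and Shafarevich. One has
  \<open>I = x I + y I + f R + g R\<close>, and modulo \<open>x I + y I\<close> the products \<open>f r\<close> and \<open>g r\<close> depend only on the
  class of \<open>r\<close> in \<open>R / I\<close>. In degree \<open>j\<close> this alone gives \<open>a\<^sub>j \<ge> 2 a\<^sub>j\<^sub>-\<^sub>1 - 2 a\<^sub>j\<^sub>-\<^sub>d\<close>, which is too weak for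
  \<open>d = 4\<close>. Cyclic invariance of \<open>F\<close> adds the syzygy \<open>f x + g y = F = x f + y g\<close>, by which
  \<open>f x w\<close> and \<open>- g y w\<close> agree modulo \<open>x I + y I\<close>. Among the words of length \<open>m = j - d\<close> that represent a
  basis of the component of degree \<open>m\<close>, at most half begin with one of the two letters, say with \<open>x\<close>.
  The products \<open>g y w\<close> can be expressed by products with \<open>f\<close>, so \<open>g\<close> need only be multiplied by this
  smaller half, and therefore \<open>a\<^sub>j \<ge> 2 a\<^sub>j\<^sub>-\<^sub>1 - (3/2) a\<^sub>j\<^sub>-\<^sub>d\<close>
  (lemma \<open>component_dim_recurrence\<close>). If \<open>a\<close> has grown by factors of at least \<open>3/2\<close> so far, then
  \<open>a\<^sub>j\<^sub>-\<^sub>d \<le> (2/3)\<^sup>3 a\<^sub>j\<^sub>-\<^sub>1\<close> because \<open>d \<ge> 4\<close>, and the next factor is at least \<open>2 - 4/9 > 3/2\<close>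
  (lemma \<open>growth_ratio\<close>).

  \<^bold>\<open>Degree 4.\<close> There is a potential whose derivatives are, up to sign, the commutators of
  \<open>z = x y - y x\<close> with \<open>x\<close> and \<open>y\<close>. Its algebra is the enveloping algebra of the Heisenberg Lie algebra,
  and it is spanned by the monomials \<open>y\<^sup>a x\<^sup>c z\<^sup>b\<close>; hence \<open>a\<^sub>j \<le> (j + 1)\<^sup>2\<close>. It maps onto the commutative
  polynomial ring in two variables; hence \<open>a\<^sub>j \<ge> j + 1\<close>. Both bounds hold over every field.
\<close>

section \<open>Linear algebra in the free algebra\<close>

lemma lookup_scalar_mult [simp]:
  "Poly_Mapping.lookup (scalar c * p) w = c * Poly_Mapping.lookup p w"
proof -
  have "scalar c * p = Poly_Mapping.map ((*) c) p"
    unfolding scalar_def zero_list_def[symmetric] by (rule mult_map_scale_conv_mult[symmetric])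
  then show ?thesis
    by (simp add: Poly_Mapping.map.rep_eq when_def)
qed

lemma scalar_mult_single [simp]:
  "scalar c * Poly_Mapping.single w a = Poly_Mapping.single w (c * a)"
  by (simp add: scalar_def mult_single plus_list_def)

lemma single_mult_scalar:
  "Poly_Mapping.single w a * scalar c = Poly_Mapping.single w (a * c)"
  by (simp add: scalar_def mult_single plus_list_def)

lemma scalar_0 [simp]: "scalar 0 = 0"
  and scalar_1 [simp]: "scalar 1 = 1"
  by (simp_all add: scalar_def flip: zero_list_def)

lemma scalar_add: "scalar (a + b) = scalar a + scalar b"
  and scalar_mult: "scalar (a * b) = scalar a * scalar b"
  by (rule poly_mapping_eqI, simp add: scalar_def lookup_add lookup_single when_def)
     (simp add: scalar_def mult_single plus_list_def)

interpretation free: vector_space "\<lambda>c p. scalar c * p :: 'k::field freealg"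
  by unfold_locales (simp_all add: algebra_simps scalar_add scalar_mult)

lemma sum_of_singles:
  assumes "finite S" "Poly_Mapping.keys p \<subseteq> S"
  shows "(\<Sum>w\<in>S. Poly_Mapping.single w (Poly_Mapping.lookup p w)) = p"
proof (rule poly_mapping_eqI)
  fix v
  show "Poly_Mapping.lookup (\<Sum>w\<in>S. Poly_Mapping.single w (Poly_Mapping.lookup p w)) v
    = Poly_Mapping.lookup p v"
    using assms by (auto simp: lookup_sum lookup_single when_def in_keys_iff)
qed

lemma scalar_central: "p * scalar c = scalar c * p"
proof -
  have "(\<Sum>w\<in>Poly_Mapping.keys p. scalar (Poly_Mapping.lookup p w) * monomial w) * scalar c
    = scalar c * (\<Sum>w\<in>Poly_Mapping.keys p. scalar (Poly_Mapping.lookup p w) * monomial w)"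
    unfolding sum_distrib_left sum_distrib_right
    by (simp add: single_mult_scalar mult.commute)
  then show ?thesis
    by (simp add: sum_of_singles)
qed

lemma linear_ext_superset:
  assumes "finite S" "Poly_Mapping.keys p \<subseteq> S"
  shows "linear_ext \<phi> p = (\<Sum>w\<in>S. scalar (Poly_Mapping.lookup p w) * \<phi> w)"
  unfolding linear_ext_def using assms
  by (intro sum.mono_neutral_left) (auto simp: in_keys_iff)

lemma linear_ext_add: "linear_ext \<phi> (p + q) = linear_ext \<phi> p + linear_ext \<phi> q"
proof -
  let ?S = "Poly_Mapping.keys p \<union> Poly_Mapping.keys q"
  have "Poly_Mapping.keys (p + q) \<subseteq> ?S"
    by (rule Poly_Mapping.keys_add)
  then show ?thesis
    by (simp add: linear_ext_superset[of ?S] lookup_add scalar_add algebra_simps sum.distrib)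
qed

lemma linear_ext_single: "linear_ext \<phi> (Poly_Mapping.single w c) = scalar c * \<phi> w"
  by (subst linear_ext_superset[of "{w}"]) auto

lemma linear_ext_mult_left: "p * linear_ext \<phi> q = linear_ext (\<lambda>w. p * \<phi> w) q"
  unfolding linear_ext_def sum_distrib_left
  by (simp add: mult.assoc[symmetric] scalar_central)

lemma linear_ext_mult_right: "linear_ext \<phi> q * p = linear_ext (\<lambda>w. \<phi> w * p) q"
  unfolding linear_ext_def sum_distrib_right by (simp add: mult.assoc)

lemma linear_ext_add_fun:
  "linear_ext \<phi> p + linear_ext \<psi> p = linear_ext (\<lambda>w. \<phi> w + \<psi> w) p"
  unfolding linear_ext_def by (simp add: sum.distrib distrib_left)

lemma linear_ext_cong:
  "(\<And>w. w \<in> Poly_Mapping.keys p \<Longrightarrow> \<phi> w = \<psi> w) \<Longrightarrow> linear_ext \<phi> p = linear_ext \<psi> p"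
  unfolding linear_ext_def by (rule sum.cong) auto

lemma monomial_mult: "monomial u * monomial v = monomial (u @ v)"
  by (simp add: mult_single plus_list_def)

lemma span_mult_left:
  assumes "p \<in> free.span B"
  shows "q * p \<in> free.span ((*) q ` B)"
  using assms
proof (induction rule: free.span_induct_alt)
  case base
  show ?case by (simp add: free.span_zero)
next
  case (step c x y)
  have "q * (scalar c * x + y) = scalar c * (q * x) + q * y"
    by (simp add: distrib_left mult.assoc[symmetric] scalar_central)
  then show ?case
    using step by (auto intro!: free.span_add free.span_scale intro: free.span_base)
qed

lemma span_mult_right:
  assumes "p \<in> free.span B"
  shows "p * q \<in> free.span ((\<lambda>b. b * q) ` B)"
  using assms
proof (induction rule: free.span_induct_alt)
  case base
  show ?case by (simp add: free.span_zero)
next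
  case (step c x y)
  then show ?case
    by (auto simp: distrib_right mult.assoc intro!: free.span_add free.span_scale intro: free.span_base)
qed

section \<open>The grading\<close>

abbreviation words :: "nat \<Rightarrow> letter list set"
  where "words j \<equiv> {w. length w = j}"

lemma UNIV_letter: "(UNIV :: letter set) = {Lx, Ly}"
  using letter.exhaust by auto

lemma finite_words [simp]: "finite (words j)"
  and card_words: "card (words j) = 2 ^ j"
proof -
  have fin: "finite (UNIV :: letter set)" and card: "card (UNIV :: letter set) = 2"
    by (simp_all add: UNIV_letter)
  from finite_lists_length_eq[OF fin, of j] show "finite (words j)" by simp
  from card_lists_length_eq[OF fin, of j] show "card (words j) = 2 ^ j" by (simp add: card)
qed

lemma homogeneousD: "p \<in> homogeneous j \<Longrightarrow> Poly_Mapping.keys p \<subseteq> words j"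
  by (auto simp: homogeneous_def)

lemma homogeneous_iff:
  "p \<in> homogeneous j \<longleftrightarrow> (\<forall>w. length w \<noteq> j \<longrightarrow> Poly_Mapping.lookup p w = 0)"
  by (auto simp: homogeneous_def in_keys_iff)

lemma subspace_homogeneous: "free.subspace (homogeneous j)"
  by (rule free.subspaceI) (auto simp: homogeneous_iff lookup_add)

lemma monomial_homogeneous: "length w = j \<Longrightarrow> monomial w \<in> homogeneous j"
  by (auto simp: homogeneous_iff lookup_single when_def)

lemma homogeneous_eq_span:
  "(homogeneous j :: 'k::field freealg set) = free.span (monomial ` words j)"
proof
  show "(homogeneous j :: 'k freealg set) \<subseteq> free.span (monomial ` words j)"
  proof
    fix p :: "'k freealg" assume "p \<in> homogeneous j"
    then have "p = (\<Sum>w\<in>words j. scalar (Poly_Mapping.lookup p w) * monomial w)"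
      by (simp add: sum_of_singles homogeneousD)
    also have "\<dots> \<in> free.span (monomial ` words j)"
      by (auto intro!: free.span_sum free.span_scale intro: free.span_base simp del: scalar_mult_single)
    finally show "p \<in> free.span (monomial ` words j)" .
  qed
  show "free.span (monomial ` words j) \<subseteq> (homogeneous j :: 'k freealg set)"
    by (rule free.span_minimal) (auto simp: subspace_homogeneous monomial_homogeneous)
qed

lemma mult_homogeneous:
  assumes "p \<in> homogeneous i" "q \<in> homogeneous j"
  shows "p * q \<in> homogeneous (i + j)"
  unfolding homogeneous_def
proof safe
  fix w assume "w \<in> Poly_Mapping.keys (p * q)"
  then obtain u v where "u \<in> Poly_Mapping.keys p" "v \<in> Poly_Mapping.keys q" "w = u @ v"
    using Poly_Mapping.keys_mult[of p q] by (auto simp: plus_list_def)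
  then show "length w = i + j"
    using assms by (simp add: homogeneous_def)
qed

lemma independent_monomials: "free.independent (monomial ` S :: 'k::field freealg set)"
  unfolding free.dependent_def
proof safe
  fix w
  assume "monomial w \<in> free.span (monomial ` S - {monomial w :: 'k freealg})"
  moreover have "free.span (monomial ` S - {monomial w}) \<subseteq> {p :: 'k freealg. Poly_Mapping.lookup p w = 0}"
    by (rule free.span_minimal)
      (auto simp: lookup_single when_def lookup_add intro!: free.subspaceI)
  ultimately show False by auto
qed

lemma inj_on_monomial: "inj_on (monomial :: letter list \<Rightarrow> 'k::field freealg) S"
  by (rule inj_onI) (metis lookup_single_eq lookup_single_not_eq zero_neq_one)

lemma card_monomial_words: "card (monomial ` words j :: 'k::field freealg set) = 2 ^ j"
  by (simp add: card_image[OF inj_on_monomial] card_words)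

definition homogeneous_part :: "nat \<Rightarrow> 'k::field freealg \<Rightarrow> 'k freealg"
  where "homogeneous_part j p = (\<Sum>w\<in>words j. scalar (Poly_Mapping.lookup p w) * monomial w)"

lemma lookup_homogeneous_part:
  "Poly_Mapping.lookup (homogeneous_part j p) w = (if length w = j then Poly_Mapping.lookup p w else 0)"
  by (auto simp: homogeneous_part_def lookup_sum lookup_single when_def)

lemma homogeneous_part_self: "p \<in> homogeneous j \<Longrightarrow> homogeneous_part j p = p"
  by (rule poly_mapping_eqI) (auto simp: lookup_homogeneous_part homogeneous_iff)

lemma homogeneous_part_other: "p \<in> homogeneous i \<Longrightarrow> i \<noteq> j \<Longrightarrow> homogeneous_part j p = 0"
  by (rule poly_mapping_eqI) (auto simp: lookup_homogeneous_part homogeneous_iff)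

text \<open>
  Projecting a linear combination of homogeneous elements to one degree discards the terms of the
  other degrees, so the grading of the free algebra restricts to every subspace with homogeneous
  generators. This is what makes the components of the ideal accessible degree by degree.
\<close>

lemma homogeneous_span_graded:
  fixes p :: "'k::field freealg"
  assumes "\<And>g. g \<in> G \<Longrightarrow> \<exists>i. g \<in> homogeneous i"
    and "p \<in> free.span G" "p \<in> homogeneous j"
  shows "p \<in> free.span (G \<inter> homogeneous j)"
proof -
  have "homogeneous_part j p \<in> free.span (G \<inter> homogeneous j)"
    using assms(2)
  proof (induction rule: free.span_induct_alt)
    case base
    have "homogeneous_part j (0 :: 'k freealg) = 0"
      by (simp add: homogeneous_part_def)
    then show ?case by (simp add: free.span_zero)
  next
    case (step c x y)
    have "homogeneous_part j (scalar c * x + y) = scalar c * homogeneous_part j x + homogeneous_part j y"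
      by (rule poly_mapping_eqI) (simp add: lookup_homogeneous_part lookup_add)
    moreover obtain i where i: "x \<in> homogeneous i"
      using assms(1) step(1) by blast
    have "homogeneous_part j x \<in> free.span (G \<inter> homogeneous j)"
      using homogeneous_part_self[of x j] homogeneous_part_other[OF i, of j] i step(1)
      by (cases "i = j") (auto intro: free.span_base free.span_zero)
    ultimately show ?case
      using step by (auto intro: free.span_add free.span_scale)
  qed
  then show ?thesis
    using assms(3) by (simp add: homogeneous_part_self)
qed

section \<open>The ideal generated by the derivatives\<close>

lemma ring_free_ring: "ring (free_ring :: 'k::field freealg ring)"
proof -
  have "\<exists>y. x + y = 0" for x :: "'k freealg"
    using add.right_inverse by blast
  then show ?thesis
    unfolding ring_of_type_algebra_def using add.right_inverse
    by unfold_locales (auto simp: algebra_simps Units_def)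
qed

lemma free_ring_simps [simp]:
  "carrier (free_ring :: 'k::field freealg ring) = UNIV"
  "monoid.mult (free_ring :: 'k::field freealg ring) p q = p * q"
  "add (free_ring :: 'k::field freealg ring) p q = p + q"
  "\<one>\<^bsub>free_ring :: 'k::field freealg ring\<^esub> = 1"
  "\<zero>\<^bsub>free_ring :: 'k::field freealg ring\<^esub> = 0"
  by (simp_all add: ring_of_type_algebra_def)

lemma free_ring_minus [simp]: "\<ominus>\<^bsub>free_ring\<^esub> p = - (p :: 'k::field freealg)"
proof -
  interpret ring "free_ring :: 'k freealg ring" by (rule ring_free_ring)
  show ?thesis by (rule minus_equality) simp_all
qed

lemma ideal_potential_ideal: "ideal (potential_ideal F) free_ring"
  unfolding potential_ideal_def
  by (rule ring.genideal_ideal[OF ring_free_ring]) simp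

lemma potential_ideal_mult:
  assumes "p \<in> potential_ideal F"
  shows "q * p \<in> potential_ideal F" "p * q \<in> potential_ideal F"
  using ideal.I_l_closed[OF ideal_potential_ideal assms, of q]
    ideal.I_r_closed[OF ideal_potential_ideal assms, of q]
  by simp_all

lemma subspace_potential_ideal: "free.subspace (potential_ideal F)"
proof -
  interpret ideal "potential_ideal F" free_ring by (rule ideal_potential_ideal)
  show ?thesis
    using additive_subgroup.zero_closed[OF is_additive_subgroup]
      additive_subgroup.a_closed[OF is_additive_subgroup]
    by (intro free.subspaceI) (auto simp: potential_ideal_mult)
qed

lemma pderivative_in_potential_ideal: "pderivative z F \<in> potential_ideal F"
proof -
  have "{pderivative Lx F, pderivative Ly F} \<subseteq> potential_ideal F"
    unfolding potential_ideal_def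
    by (rule ring.genideal_self[OF ring_free_ring]) simp
  then show ?thesis by (cases z) auto
qed

definition ideal_generators :: "'k::field freealg \<Rightarrow> 'k freealg set"
  where "ideal_generators F = {monomial u * pderivative z F * monomial v | u z v. True}"

lemma span_ideal_generators_mult:
  assumes p: "p \<in> free.span (ideal_generators F)"
  shows "q * p \<in> free.span (ideal_generators F)" "p * q \<in> free.span (ideal_generators F)"
proof -
  have l: "monomial w * p \<in> free.span (ideal_generators F)" for w
  proof -
    have "(*) (monomial w) ` ideal_generators F \<subseteq> ideal_generators F"
    proof safe
      fix g assume "g \<in> ideal_generators F"
      then obtain u z v where "g = monomial u * pderivative z F * monomial v"
        by (auto simp: ideal_generators_def)
      then have "monomial w * g = monomial (w @ u) * pderivative z F * monomial v"
        by (simp add: mult.assoc flip: monomial_mult)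
      then show "monomial w * g \<in> ideal_generators F"
        unfolding ideal_generators_def by blast
    qed
    then show ?thesis
      using span_mult_left[OF p] free.span_mono by blast
  qed
  have r: "p * monomial w \<in> free.span (ideal_generators F)" for w
  proof -
    have "(\<lambda>g. g * monomial w) ` ideal_generators F \<subseteq> ideal_generators F"
    proof safe
      fix g assume "g \<in> ideal_generators F"
      then obtain u z v where "g = monomial u * pderivative z F * monomial v"
        by (auto simp: ideal_generators_def)
      then have "g * monomial w = monomial u * pderivative z F * monomial (v @ w)"
        by (simp add: mult.assoc flip: monomial_mult)
      then show "g * monomial w \<in> ideal_generators F"
        unfolding ideal_generators_def by blast
    qed
    then show ?thesis
      using span_mult_right[OF p] free.span_mono by blast
  qed
  have q: "q = (\<Sum>w\<in>Poly_Mapping.keys q. scalar (Poly_Mapping.lookup q w) * monomial w)"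
    by (simp add: sum_of_singles)
  show "q * p \<in> free.span (ideal_generators F)"
    by (subst q) (auto simp: sum_distrib_right mult.assoc intro!: free.span_sum free.span_scale l
      simp del: scalar_mult_single)
  have "p * (scalar c * monomial w) = scalar c * (p * monomial w)" for c w
    by (metis mult.assoc scalar_central)
  then show "p * q \<in> free.span (ideal_generators F)"
    by (subst q) (auto simp only: sum_distrib_left intro!: free.span_sum free.span_scale r)
qed

text \<open>
  The span of the products \<open>u f v\<close> and \<open>u g v\<close> with words \<open>u\<close>, \<open>v\<close> is already closed under
  multiplication from both sides, by the preceding lemma.
\<close>

lemma potential_ideal_eq_span:
  "potential_ideal (F :: 'k::field freealg) = free.span (ideal_generators F)"
proof
  let ?J = "free.span (ideal_generators F)"
  have "pderivative z F \<in> ?J" for z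
  proof -
    have "pderivative z F = monomial [] * pderivative z F * monomial []"
      by (simp flip: zero_list_def)
    then have "pderivative z F \<in> ideal_generators F"
      unfolding ideal_generators_def by blast
    then show ?thesis by (rule free.span_base)
  qed
  moreover have "ideal ?J (free_ring :: 'k freealg ring)"
  proof (rule idealI[OF ring_free_ring])
    show "subgroup ?J (add_monoid (free_ring :: 'k freealg ring))"
    proof -
      interpret ring "free_ring :: 'k freealg ring" by (rule ring_free_ring)
      show ?thesis
        using free.span_zero[of "ideal_generators F"]
        by (intro add.subgroupI)
          (auto simp: free.span_neg free.span_add)
    qed
  qed (auto simp: span_ideal_generators_mult)
  ultimately show "potential_ideal F \<subseteq> ?J"
    unfolding potential_ideal_def by (intro ring.genideal_minimal[OF ring_free_ring]) auto
  have "monomial u * pderivative z F * monomial v \<in> potential_ideal F" for u z v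
    by (intro potential_ideal_mult pderivative_in_potential_ideal)
  then show "?J \<subseteq> potential_ideal F"
    by (intro free.span_minimal) (auto simp: ideal_generators_def subspace_potential_ideal)
qed

section \<open>Dimensions of the components\<close>

lemma subfield_scalars: "subfield (range scalar) (free_ring :: 'k::field freealg ring)"
proof -
  interpret ring "free_ring :: 'k freealg ring" by (rule ring_free_ring)
  have neg: "- scalar c = scalar (- c)" for c :: 'k
    by (simp add: scalar_def single_uminus)
  have "subring (range scalar) (free_ring :: 'k freealg ring)"
    by (rule subringI)
      (auto simp: neg image_iff simp flip: scalar_add scalar_mult intro: exI[of _ 1])
  then have cring: "subcring (range scalar) (free_ring :: 'k freealg ring)"
    by (rule subcringI) (auto simp: mult.commute simp flip: scalar_mult)
  have "Units ((free_ring :: 'k freealg ring)\<lparr>carrier := range scalar\<rparr>) = range scalar - {0}"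
  proof (intro equalityI subsetI)
    fix p :: "'k freealg" assume "p \<in> range scalar - {0}"
    then obtain c where c: "p = scalar c" "c \<noteq> 0"
      by (metis Diff_iff rangeE scalar_0 singletonI)
    then have "scalar (inverse c) * p = 1" "p * scalar (inverse c) = 1"
      by (simp_all flip: scalar_mult)
    then show "p \<in> Units (free_ring\<lparr>carrier := range scalar\<rparr>)"
      using c unfolding Units_def by auto
  qed (auto simp: Units_def)
  then show ?thesis
    by (intro subfieldI[OF cring]) simp
qed

text \<open>
  The dimension used for the quotient is defined for modules inside an abstract ring, whereas bases
  and spans in the free algebra are those of a vector space over the field itself. The two
  notions agree because both build a space by adjoining one independent vector at a time.
\<close>

lemma dimension_span:
  assumes "finite B" "free.independent B"
  shows "ring.dimension (free_ring :: 'k::field freealg ring) (card B) (range scalar) (free.span B)"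
  using assms
proof (induction B rule: finite_induct)
  case empty
  interpret ring "free_ring :: 'k freealg ring" by (rule ring_free_ring)
  show ?case using zero_dim[of "range scalar"] by simp
next
  case (insert b B)
  interpret ring "free_ring :: 'k freealg ring" by (rule ring_free_ring)
  have "line_extension (range scalar) b (free.span B) = free.span (insert b B)"
  proof -
    have "line_extension (range scalar) b (free.span B) = (\<Union>c. \<Union>e\<in>free.span B. {scalar c * b + e})"
      unfolding line_extension_def set_add_def set_mult_def r_coset_def
      by auto
    also have "\<dots> = free.span (insert b B)"
    proof (intro equalityI subsetI)
      fix x assume "x \<in> free.span (insert b B)"
      then obtain k where "x - scalar k * b \<in> free.span B"
        by (auto simp: free.span_insert)
      then show "x \<in> (\<Union>c. \<Union>e\<in>free.span B. {scalar c * b + e})"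
        by (intro UN_I[of k] UN_I[of "x - scalar k * b"]) auto
    qed (auto simp: free.span_insert, metis add_diff_cancel_left')
    finally show ?thesis .
  qed
  moreover have "b \<notin> free.span B" "free.independent B"
    using insert by (auto simp: free.independent_insert)
  ultimately show ?case
    using Suc_dim[of b "free.span B" "card B" "range scalar"] insert
    by simp
qed

text \<open>
  Rank and nullity for the quotient map on the elements of degree \<open>j\<close>. The ideal must be proper for
  the scalars to remain a field in the quotient.
\<close>

lemma component_dim_eq:
  fixes F :: "'k::field freealg" and B C :: "'k freealg set"
  assumes "1 \<notin> potential_ideal F"
    and C: "finite C" "free.independent C" "free.span C = homogeneous j"
    and B: "finite B" "free.independent B" "free.span B = potential_ideal F \<inter> homogeneous j"
  shows "component_dim F j = card C - card B"
proof -
  interpret ideal "potential_ideal F" free_ring by (rule ideal_potential_ideal)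
  have carrier: "carrier (free_ring\<lparr>carrier := S\<rparr>) = S" for S :: "'k freealg set"
    by simp
  interpret Q: ring_hom_ring free_ring "potential_algebra F" "quotient_map F"
    using rcos_ring_hom_ring unfolding potential_algebra_def quotient_map_def .
  have zero_iff: "quotient_map F p = \<zero>\<^bsub>potential_algebra F\<^esub> \<longleftrightarrow> p \<in> potential_ideal F" for p
  proof -
    have "\<zero>\<^bsub>potential_algebra F\<^esub> = potential_ideal F"
      by (simp add: potential_algebra_def FactRing_def)
    moreover have "p \<in> quotient_map F p"
      unfolding quotient_map_def by (rule a_rcos_self) simp
    moreover have "quotient_map F p = potential_ideal F" if "p \<in> potential_ideal F"
      unfolding quotient_map_def using that by (rule a_rcos_const)
    ultimately show ?thesis by auto
  qed
  have one: "\<one>\<^bsub>potential_algebra F\<^esub> \<noteq> \<zero>\<^bsub>potential_algebra F\<^esub>"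
    using zero_iff[of 1] assms(1) Q.hom_one by auto
  have ker: "a_kernel (free_ring\<lparr>carrier := homogeneous j\<rparr>) (potential_algebra F) (quotient_map F)
    = potential_ideal F \<inter> homogeneous j"
    unfolding a_kernel_def' zero_iff carrier by blast
  have "Q.S.dimension (card C - card B) (quotient_map F ` range scalar) (quotient_map F ` homogeneous j)"
    by (rule Q.rank_nullity_theorem[OF subfield_scalars one])
      (use dimension_span[OF C(1,2)] dimension_span[OF B(1,2)] ker in \<open>simp_all add: B C\<close>)
  moreover have "subfield (quotient_map F ` range scalar) (potential_algebra F)"
    by (rule Q.img_is_subfield(2)[OF subfield_scalars one])
  ultimately show ?thesis
    unfolding component_dim_def component_def using Q.S.dimI by (simp add: over_def)
qed

section \<open>Homogeneous potentials\<close>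

locale homogeneous_potential =
  fixes F :: "'k::field freealg" and n :: nat
  assumes homogeneous: "F \<in> homogeneous n"
    and potential: "potential F"
    and degree: "2 \<le> n"
begin

definition ideal_part :: "nat \<Rightarrow> 'k freealg set"
  where "ideal_part j = potential_ideal F \<inter> homogeneous j"

lemma subspace_ideal_part: "free.subspace (ideal_part j)"
  unfolding ideal_part_def
  by (intro free.subspace_inter subspace_potential_ideal subspace_homogeneous)

lemma pderivative_homogeneous: "pderivative z F \<in> homogeneous (n - 1)"
  unfolding pderivative_def linear_ext_def
proof (intro free.subspace_sum[OF subspace_homogeneous] free.subspace_scale[OF subspace_homogeneous])
  fix w assume "w \<in> Poly_Mapping.keys F"
  then have "length w = n"
    using homogeneous by (auto simp: homogeneous_def)
  then show "(case w of [] \<Rightarrow> 0 | z' # u \<Rightarrow> if z' = z then monomial u else 0) \<in> homogeneous (n - 1)"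
    using free.subspace_0[OF subspace_homogeneous]
    by (auto split: list.split intro!: monomial_homogeneous)
qed

text \<open>
  Splitting off the first letter of every word recovers \<open>F\<close>; moving it to the end gives the cyclic
  shift of \<open>F\<close>, which is \<open>F\<close> again. The two identities together form the syzygy between the
  derivatives.
\<close>

lemma left_euler: "monomial [Lx] * pderivative Lx F + monomial [Ly] * pderivative Ly F = F"
proof -
  have "monomial [Lx] * pderivative Lx F + monomial [Ly] * pderivative Ly F = linear_ext monomial F"
    unfolding pderivative_def linear_ext_mult_left linear_ext_add_fun
  proof (rule linear_ext_cong)
    fix w assume "w \<in> Poly_Mapping.keys F"
    then have "length w = n"
      using homogeneous by (auto simp: homogeneous_def)
    then obtain c u where "w = c # u"
      using degree by (cases w) auto
    then show "monomial [Lx] * (case w of [] \<Rightarrow> 0 | z' # u \<Rightarrow> if z' = Lx then monomial u else 0) +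
        monomial [Ly] * (case w of [] \<Rightarrow> 0 | z' # u \<Rightarrow> if z' = Ly then monomial u else 0) =
        (monomial w :: 'k freealg)"
      by (cases c) (simp_all add: monomial_mult)
  qed
  then show ?thesis
    by (simp add: linear_ext_def sum_of_singles)
qed

lemma right_euler: "pderivative Lx F * monomial [Lx] + pderivative Ly F * monomial [Ly] = F"
proof -
  have "pderivative Lx F * monomial [Lx] + pderivative Ly F * monomial [Ly] = cyclic_shift F"
    unfolding pderivative_def cyclic_shift_def linear_ext_mult_right linear_ext_add_fun
  proof (rule linear_ext_cong)
    fix w assume "w \<in> Poly_Mapping.keys F"
    then have "length w = n"
      using homogeneous by (auto simp: homogeneous_def)
    then obtain c u where "w = c # u"
      using degree by (cases w) auto
    then show "(case w of [] \<Rightarrow> 0 | z' # u \<Rightarrow> if z' = Lx then monomial u else 0) * monomial [Lx] +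
        (case w of [] \<Rightarrow> 0 | z' # u \<Rightarrow> if z' = Ly then monomial u else 0) * monomial [Ly] =
        ((case w of [] \<Rightarrow> monomial [] | z # u \<Rightarrow> monomial (u @ [z])) :: 'k freealg)"
      by (cases c) (simp_all add: monomial_mult)
  qed
  then show ?thesis
    using potential by (simp add: potential_def)
qed

lemma syzygy:
  assumes "z \<noteq> z'"
  shows "pderivative z' F * monomial [z'] =
    monomial [z] * pderivative z F + monomial [z'] * pderivative z' F - pderivative z F * monomial [z]"
  using left_euler right_euler assms by (cases z; cases z') (auto simp: algebra_simps)

lemma ideal_part_span:
  "ideal_part j \<subseteq> free.span {monomial u * pderivative z F * monomial v |u z v.
     length u + length v + (n - 1) = j}" (is "_ \<subseteq> free.span ?G")
proof -
  have hom: "monomial u * pderivative z F * monomial v \<in> homogeneous (length u + (n - 1) + length v)"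
    for u z v
    by (intro mult_homogeneous pderivative_homogeneous monomial_homogeneous refl)
  have "ideal_generators F \<inter> homogeneous j \<subseteq> free.span ?G"
  proof safe
    fix g assume g: "g \<in> ideal_generators F" "g \<in> homogeneous j"
    then obtain u z v where g_eq: "g = monomial u * pderivative z F * monomial v"
      by (auto simp: ideal_generators_def)
    show "g \<in> free.span ?G"
    proof (cases "length u + length v + (n - 1) = j")
      case True
      then have "g \<in> ?G" using g_eq by blast
      then show ?thesis by (rule free.span_base)
    next
      \<comment> \<open>A generator of two different degrees is \<open>0\<close>; this happens when a derivative vanishes.\<close>
      case False
      then have "homogeneous_part j g = 0"
        using homogeneous_part_other[OF hom[of u z v], of j] by (simp add: g_eq add_ac)
      then have "g = 0" using homogeneous_part_self[OF g(2)] by simp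
      then show ?thesis by (simp add: free.span_zero)
    qed
  qed
  then have "free.span (ideal_generators F \<inter> homogeneous j) \<subseteq> free.span ?G"
    by (rule free.span_minimal) (rule free.subspace_span)
  moreover have "ideal_part j \<subseteq> free.span (ideal_generators F \<inter> homogeneous j)"
  proof
    fix p assume "p \<in> ideal_part j"
    then show "p \<in> free.span (ideal_generators F \<inter> homogeneous j)"
      unfolding ideal_part_def potential_ideal_eq_span
      by (intro homogeneous_span_graded) (auto simp: ideal_generators_def intro: hom)
  qed
  ultimately show ?thesis by blast
qed

lemma ideal_part_below:
  assumes "j < n - 1"
  shows "ideal_part j \<subseteq> {0}"
proof -
  have "{monomial u * pderivative z F * monomial v |u z v. length u + length v + (n - 1) = j} = {}"
    using assms by auto
  then show ?thesis using ideal_part_span[of j] by (metis free.span_empty)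
qed

lemma one_not_in_potential_ideal: "1 \<notin> potential_ideal F"
proof
  assume "1 \<in> potential_ideal F"
  moreover have "(1 :: 'k freealg) \<in> homogeneous 0"
    using monomial_homogeneous[of "[]" 0] by (simp flip: zero_list_def)
  ultimately have "1 \<in> ideal_part 0" by (simp add: ideal_part_def)
  then show False using ideal_part_below[of 0] degree by auto
qed

text \<open>
  Extending a basis \<open>B\<close> of the ideal in degree \<open>j\<close> by words shows that a basis of the component of
  degree \<open>j\<close> can be represented by a set \<open>C\<close> of words. Having words rather than arbitrary polynomials
  matters twice: they can be sorted by their first letter, and each has a well-defined number of
  occurrences of \<open>x\<close>.
\<close>

lemma normal_words:
  obtains B C where
    "finite B" "free.independent B" "free.span B = ideal_part j"
    "C \<subseteq> words j" "homogeneous j = free.span (B \<union> monomial ` C)"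
    "card C = component_dim F j" "card B + component_dim F j = 2 ^ j"
proof -
  obtain B where B: "B \<subseteq> ideal_part j" "free.independent B" "ideal_part j \<subseteq> free.span B"
    "card B = free.dim (ideal_part j)"
    by (rule free.basis_exists)
  have span_B: "free.span B = ideal_part j"
    using free.span_minimal[OF B(1) subspace_ideal_part] B(3) by (rule equalityI)
  let ?V = "B \<union> monomial ` words j"
  obtain D where D: "B \<subseteq> D" "D \<subseteq> ?V" "free.independent D" "?V \<subseteq> free.span D"
    using free.maximal_independent_subset_extend[OF _ B(2), of ?V] by (metis Un_upper1)
  have B_hom: "B \<subseteq> homogeneous j"
    using B(1) by (auto simp: ideal_part_def)
  have "D \<subseteq> homogeneous j"
    using D(2) B_hom by (auto intro!: monomial_homogeneous)
  then have span_D: "free.span D = homogeneous j"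
    using D(4) free.span_minimal[OF _ subspace_homogeneous, of D j]
      free.span_minimal[OF _ free.subspace_span, of "monomial ` words j" D]
    unfolding homogeneous_eq_span by auto
  have fin_words: "finite (monomial ` words j :: 'k freealg set)"
    by simp
  have "free.independent (monomial ` words j :: 'k freealg set)"
    by (rule independent_monomials)
  then have "card D = card (monomial ` words j :: 'k freealg set)"
    using free.dim_span_eq_card_independent[OF D(3)] free.dim_span_eq_card_independent
    by (metis span_D homogeneous_eq_span)
  then have card_D: "card D = 2 ^ j"
    by (simp add: card_monomial_words)
  have "finite D"
    using free.independent_span_bound[OF fin_words D(3)] span_D free.span_superset[of D]
    unfolding homogeneous_eq_span by auto
  then have fin_B: "finite B" using D(1) finite_subset by blast
  define C where "C = {w \<in> words j. monomial w \<in> D - B}"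
  have C: "monomial ` C = D - B"
    using D(1,2) by (auto simp: C_def)
  have card_C: "card (monomial ` C :: 'k freealg set) = card C"
    by (rule card_image[OF inj_on_monomial])
  have dim: "component_dim F j = card D - card B"
    using component_dim_eq[OF one_not_in_potential_ideal \<open>finite D\<close> D(3) span_D fin_B B(2)] span_B
    by (simp add: ideal_part_def)
  have le: "card B \<le> card D"
    using D(1) \<open>finite D\<close> by (rule card_mono[rotated])
  show ?thesis
  proof (rule that[of B C])
    show "card C = component_dim F j"
      using card_C D(1) fin_B by (simp add: C dim card_Diff_subset)
    show "homogeneous j = free.span (B \<union> monomial ` C)"
      using D(1) by (simp add: C span_D Un_absorb1)
  qed (use B fin_B span_B le card_D dim in \<open>auto simp: C_def\<close>)
qed

lemma component_dim_below:
  assumes "j < n - 1"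
  shows "component_dim F j = 2 ^ j"
proof -
  obtain B C where B: "finite B" "free.independent B" "free.span B = ideal_part j"
    "card B + component_dim F j = 2 ^ j"
    by (rule normal_words)
  have "B \<subseteq> {0}"
    using B(3) free.span_superset[of B] ideal_part_below[OF assms] by blast
  then have "B = {}"
    using B(2) free.dependent_zero by blast
  then show ?thesis using B(4) by simp
qed

text \<open>
  In the lowest degree of the relations the syzygy does not help yet, and the two derivatives may be
  independent.
\<close>

lemma component_dim_degree:
  "2 ^ (n - 1) \<le> component_dim F (n - 1) + 2"
proof -
  obtain B C where B: "finite B" "free.independent B" "free.span B = ideal_part (n - 1)"
    "card B + component_dim F (n - 1) = 2 ^ (n - 1)"
    by (rule normal_words)
  let ?G = "{pderivative Lx F, pderivative Ly F}"
  have "monomial u * pderivative z F * monomial v \<in> ?G"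
    if "length u + length v + (n - 1) = n - 1" for u z v
    using that by (cases z) (simp_all flip: zero_list_def)
  then have "B \<subseteq> free.span ?G"
    using ideal_part_span[of "n - 1"] B(3) free.span_superset[of B]
      free.span_mono[of "{monomial u * pderivative z F * monomial v |u z v.
        length u + length v + (n - 1) = n - 1}" ?G] by blast
  then have "card B \<le> card ?G"
    using free.independent_span_bound[of ?G B] B(2) by simp
  also have "\<dots> \<le> 2"
    by (simp add: card_insert_if)
  finally show ?thesis using B(4) by linarith
qed

text \<open>
  The refined Golod--Shafarevich inequality in degree \<open>j = m + n - 1\<close>. With \<open>B\<close> a basis of the ideal in
  degree \<open>j - 1\<close> and \<open>C\<close> a set of words representing a basis of the component of degree \<open>m\<close>, the ideal
  in degree \<open>j\<close> is spanned by \<open>x B\<close>, \<open>y B\<close>, the products of one derivative with \<open>C\<close>, and the products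
  of the other with those words of \<open>C\<close> that begin with the rarer letter. The hypothesis on \<open>m\<close>
  is needed because the empty word has no first letter.
\<close>

lemma component_dim_recurrence:
  assumes "1 \<le> m"
  shows "4 * component_dim F (m + n - 2) \<le> 2 * component_dim F (m + n - 1) + 3 * component_dim F m"
proof -
  obtain B where B: "free.span B = ideal_part (m + n - 2)" and fin_B: "finite B"
    and card_B: "card B + component_dim F (m + n - 2) = 2 ^ (m + n - 2)"
    by (rule normal_words)
  obtain Bm C where Bm: "free.span Bm = ideal_part m" and C: "C \<subseteq> words m"
    and span_C: "homogeneous m = free.span (Bm \<union> monomial ` C)"
    and card_C: "card C = component_dim F m"
    by (rule normal_words)
  obtain Bj where Bj: "free.independent Bj" "free.span Bj = ideal_part (m + n - 1)"
    and card_Bj: "card Bj + component_dim F (m + n - 1) = 2 ^ (m + n - 1)"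
    by (rule normal_words)
  have fin_C: "finite C" by (rule finite_subset[OF C finite_words])
  \<comment> \<open>Below, \<open>z\<close> is the rarer first letter and \<open>z'\<close> the other one; the derivative by \<open>z\<close> is multiplied by all
    of \<open>C\<close>, the derivative by \<open>z'\<close> only by the words that begin with \<open>z\<close>.\<close>
  define C' where "C' z = {w \<in> C. hd w = z}" for z
  have "hd w = Lx \<or> hd w = Ly" for w
    by (cases "hd w") auto
  then have "C' Lx \<union> C' Ly = C" "C' Lx \<inter> C' Ly = {}"
    by (auto simp: C'_def)
  then have "card C = card (C' Lx) + card (C' Ly)"
    using card_Un_disjoint[of "C' Lx" "C' Ly"] fin_C by (simp add: C'_def)
  then have "2 * card (C' Lx) \<le> card C \<or> 2 * card (C' Ly) \<le> card C"
    by linarith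
  then obtain z z' where z: "z \<noteq> z'" "2 * card (C' z) \<le> card C"
    by (metis letter.distinct(1))
  let ?low = "(*) (monomial [Lx]) ` B \<union> (*) (monomial [Ly]) ` B"
  let ?S = "?low \<union> (*) (pderivative z F) ` monomial ` C \<union> (*) (pderivative z' F) ` monomial ` C' z"
  have low: "monomial [c] * p \<in> free.span ?low" if "p \<in> ideal_part (m + n - 2)" for c p
  proof -
    have "monomial [c] * p \<in> free.span ((*) (monomial [c]) ` B)"
      using span_mult_left that B by blast
    then show ?thesis
      using free.span_mono[of "(*) (monomial [c]) ` B" ?low] by (cases c) auto
  qed
  have low_S: "free.span ?low \<subseteq> free.span ?S"
    by (rule free.span_mono) blast
  \<comment> \<open>Each term of a derivative \<open>f\<close> starts with a letter, which is split off: \<open>f I\<close> lies in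
    \<open>x I + y I\<close>, so only classes modulo the ideal count in the products \<open>f r\<close>.\<close>
  have mult_ideal: "pderivative c F * p \<in> free.span ?S" if p: "p \<in> ideal_part m" for c p
  proof -
    have "pderivative c F \<in> free.span (monomial ` words (n - 1))"
      using pderivative_homogeneous homogeneous_eq_span by blast
    then have "pderivative c F * p \<in> free.span ((\<lambda>b. b * p) ` monomial ` words (n - 1))"
      by (rule span_mult_right)
    also have "\<dots> \<subseteq> free.span ?low"
    proof (rule free.span_minimal)
      show "(\<lambda>b. b * p) ` monomial ` words (n - 1) \<subseteq> free.span ?low"
      proof safe
        fix w :: "letter list" assume "length w = n - 1"
        then obtain e u where w: "w = e # u" "length u = n - 2"
          using degree by (cases w) auto
        have "monomial u * p \<in> homogeneous (n - 2 + m)"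
          using p w by (intro mult_homogeneous monomial_homogeneous) (auto simp: ideal_part_def)
        then have "monomial u * p \<in> ideal_part (m + n - 2)"
          using p degree by (simp add: ideal_part_def potential_ideal_mult add.commute)
        moreover have "monomial w * p = monomial [e] * (monomial u * p)"
          by (simp add: w monomial_mult flip: mult.assoc)
        ultimately show "monomial w * p \<in> free.span ?low"
          using low by simp
      qed
    qed (rule free.subspace_span)
    finally show ?thesis using low_S by blast
  qed
  have first: "pderivative z F * p \<in> free.span ?S" if "p \<in> homogeneous m" for p
  proof -
    have "pderivative z F * p \<in> free.span ((*) (pderivative z F) ` (Bm \<union> monomial ` C))"
      using that span_C span_mult_left by blast
    also have "\<dots> \<subseteq> free.span ?S"
      using Bm free.span_superset[of Bm] mult_ideal
      by (intro free.span_minimal) (auto intro: free.span_base)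
    finally show ?thesis .
  qed
  have second: "pderivative z' F * p \<in> free.span ?S" if "p \<in> homogeneous m" for p
  proof -
    have word: "pderivative z' F * monomial w \<in> free.span ?S" if "w \<in> C" for w
    proof (cases "hd w = z")
      case True
      then show ?thesis using that by (auto simp: C'_def intro!: free.span_base)
    next
      case False
      have "length w = m" using that C by auto
      then obtain e u where "w = e # u" "length u = m - 1"
        using assms by (cases w) auto
      moreover have "e = z'" if "e \<noteq> z"
        using that z(1) by (cases e; cases z; cases z') auto
      ultimately have w: "w = z' # u" "length u = m - 1"
        using False by auto
      have low_u: "monomial [c] * (pderivative c F * monomial u) \<in> free.span ?S" for c
      proof -
        have "pderivative c F * monomial u \<in> homogeneous (n - 1 + (m - 1))"
          by (intro mult_homogeneous pderivative_homogeneous monomial_homogeneous w(2))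
        moreover have "n - 1 + (m - 1) = m + n - 2"
          using assms degree by simp
        ultimately have "pderivative c F * monomial u \<in> ideal_part (m + n - 2)"
          by (simp add: ideal_part_def potential_ideal_mult pderivative_in_potential_ideal)
        then show ?thesis using low low_S by blast
      qed
      \<comment> \<open>For a word starting with \<open>z'\<close> the syzygy trades the derivative by \<open>z'\<close> for the one by \<open>z\<close>.\<close>
      have "pderivative z F * monomial (z # u) \<in> free.span ?S"
        using w(2) assms by (intro first monomial_homogeneous) simp
      moreover have "pderivative z' F * monomial w = (pderivative z' F * monomial [z']) * monomial u"
        by (simp add: w monomial_mult mult.assoc)
      then have "pderivative z' F * monomial w = monomial [z] * (pderivative z F * monomial u)
        + monomial [z'] * (pderivative z' F * monomial u) - pderivative z F * monomial (z # u)"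
        by (simp add: syzygy[OF z(1)] algebra_simps monomial_mult)
      ultimately show ?thesis
        using low_u by (simp add: free.span_add free.span_diff)
    qed
    have "pderivative z' F * p \<in> free.span ((*) (pderivative z' F) ` (Bm \<union> monomial ` C))"
      using that span_C span_mult_left by blast
    also have "\<dots> \<subseteq> free.span ?S"
      using Bm free.span_superset[of Bm] mult_ideal word
      by (intro free.span_minimal) auto
    finally show ?thesis .
  qed
  have deriv: "pderivative c F * p \<in> free.span ?S" if "p \<in> homogeneous m" for c p
    using first[OF that] second[OF that] z(1) by (cases c; cases z; cases z') auto
  have "ideal_part (m + n - 1) \<subseteq> free.span ?S"
  proof (rule order.trans[OF ideal_part_span], rule free.span_minimal)
    show "{monomial u * pderivative c F * monomial v |u c v. length u + length v + (n - 1) = m + n - 1}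
      \<subseteq> free.span ?S"
    proof safe
      fix u c v assume len: "length (u :: letter list) + length (v :: letter list) + (n - 1) = m + n - 1"
      show "monomial u * pderivative c F * monomial v \<in> free.span ?S"
      proof (cases u)
        case Nil
        then have "monomial v \<in> (homogeneous m :: 'k freealg set)"
          using len degree by (intro monomial_homogeneous) simp
        then show ?thesis
          using deriv Nil by (simp flip: zero_list_def)
      next
        case (Cons e u')
        have "monomial u' * pderivative c F * monomial v \<in> homogeneous (length u' + (n - 1) + length v)"
          by (intro mult_homogeneous pderivative_homogeneous monomial_homogeneous refl)
        moreover have "length u' + (n - 1) + length v = m + n - 2"
          using len Cons degree by simp
        ultimately have "monomial u' * pderivative c F * monomial v \<in> ideal_part (m + n - 2)"
          by (simp add: ideal_part_def potential_ideal_mult pderivative_in_potential_ideal)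
        moreover have "monomial u * pderivative c F * monomial v
          = monomial [e] * (monomial u' * pderivative c F * monomial v)"
          by (simp add: Cons monomial_mult flip: mult.assoc)
        ultimately show ?thesis
          using low low_S by auto
      qed
    qed
  qed (rule free.subspace_span)
  then have "Bj \<subseteq> free.span ?S"
    using Bj(2) free.span_superset[of Bj] by blast
  moreover have "finite ?S"
    using fin_B fin_C by (simp add: C'_def)
  ultimately have "card Bj \<le> card ?S"
    using free.independent_span_bound[OF _ Bj(1), of ?S] by simp
  also have "\<dots> \<le> card B + card B + card C + card (C' z)"
  proof -
    have "finite (C' z)" using fin_C by (simp add: C'_def)
    then have "card ((*) (pderivative z F) ` monomial ` C) \<le> card C"
      "card ((*) (pderivative z' F) ` monomial ` C' z) \<le> card (C' z)"
      using fin_C by (simp_all add: image_image card_image_le)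
    moreover have "card ?low \<le> card B + card B"
      using card_Un_le[of "(*) (monomial [Lx]) ` B" "(*) (monomial [Ly]) ` B"]
        card_image_le[OF fin_B, of "(*) (monomial [Lx])"] card_image_le[OF fin_B, of "(*) (monomial [Ly])"]
      by linarith
    ultimately show ?thesis
      using card_Un_le[of ?low "(*) (pderivative z F) ` monomial ` C"]
        card_Un_le[of "?low \<union> (*) (pderivative z F) ` monomial ` C" "(*) (pderivative z' F) ` monomial ` C' z"]
      by linarith
  qed
  finally have "2 * card Bj \<le> 4 * card B + 3 * component_dim F m"
    using z(2) card_C by linarith
  moreover have "m + n - 1 = Suc (m + n - 2)"
    using degree by simp
  then have "(2::nat) ^ (m + n - 1) = 2 * 2 ^ (m + n - 2)"
    by simp
  ultimately show ?thesis
    using card_B card_Bj by linarith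
qed

text \<open>
  If \<open>S\<close> spans the words of degree \<open>j\<close> modulo the ideal, then it does so together with a basis of the
  ideal in that degree alone, because the error \<open>p - s\<close> is again homogeneous of degree \<open>j\<close>.
\<close>

lemma component_dim_le:
  assumes "finite S" "S \<subseteq> homogeneous j" "homogeneous j \<subseteq> free.span (S \<union> potential_ideal F)"
  shows "component_dim F j \<le> card S"
proof -
  obtain B where B: "finite B" "free.span B = ideal_part j"
    and card_B: "card B + component_dim F j = 2 ^ j"
    by (rule normal_words)
  have span_I: "free.span (potential_ideal F) = potential_ideal F"
    using subspace_potential_ideal by simp
  have "homogeneous j \<subseteq> free.span (S \<union> B)"
  proof
    fix p :: "'k freealg" assume p: "p \<in> homogeneous j"
    then obtain s q where sq: "p = s + q" "s \<in> free.span S" "q \<in> potential_ideal F"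
      using assms(3) free.span_Un[of S "potential_ideal F"] span_I by auto
    have "s \<in> homogeneous j"
      using free.span_minimal[OF assms(2) subspace_homogeneous] sq(2) by blast
    then have "p - s \<in> homogeneous j"
      using p by (intro free.subspace_diff[OF subspace_homogeneous])
    then have "q \<in> free.span B"
      using sq(1,3) B(2) by (simp add: ideal_part_def)
    then show "p \<in> free.span (S \<union> B)"
      using sq(1,2) free.span_Un[of S B] by auto
  qed
  then have "(monomial ` words j :: 'k freealg set) \<subseteq> free.span (S \<union> B)"
    using free.span_superset[of "monomial ` words j :: 'k freealg set"] homogeneous_eq_span by blast
  moreover have "free.independent (monomial ` words j :: 'k freealg set)"
    by (rule independent_monomials)
  ultimately have "card (monomial ` words j :: 'k freealg set) \<le> card (S \<union> B)"
    using free.independent_span_bound[of "S \<union> B"] assms(1) B(1) by simp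
  then have "2 ^ j \<le> card (S \<union> B)"
    by (simp add: card_monomial_words)
  then show ?thesis
    using card_Un_le[of S B] card_B by linarith
qed

end

section \<open>Exponential growth in degree at least 5\<close>

text \<open>
  Let \<open>m = j + 1 - d\<close>. By the ratios already known, \<open>27 a\<^sub>m \<le> 8 a\<^sub>m\<^sub>+\<^sub>3 \<le> 8 a\<^sub>j\<close>, where \<open>m + 3 \<le> j\<close> is exactly the bound
  \<open>d \<ge> 4\<close>. The recurrence then gives \<open>2 a\<^sub>j\<^sub>+\<^sub>1 \<ge> (4 - 8/9) a\<^sub>j\<close>, more than required.
\<close>

lemma growth_ratio:
  fixes a :: "nat \<Rightarrow> nat"
  assumes d: "4 \<le> d"
    and below: "\<And>j. j < d \<Longrightarrow> a j = 2 ^ j"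
    and at: "2 ^ d \<le> a d + 2"
    and above: "\<And>m. 1 \<le> m \<Longrightarrow> 4 * a (m + d - 1) \<le> 2 * a (m + d) + 3 * a m"
  shows "3 * a j \<le> 2 * a (Suc j)"
proof (induction j rule: less_induct)
  case (less j)
  consider "Suc j < d" | "Suc j = d" | "d < Suc j" by linarith
  then show ?case
  proof cases
    case 1
    then show ?thesis by (simp add: below)
  next
    case 2
    have "(2::nat) ^ 3 \<le> 2 ^ j"
      using 2 d by (intro power_increasing) auto
    then show ?thesis
      using at 2[symmetric] below[of j] by simp
  next
    case 3
    define m where "m = Suc j - d"
    have m: "1 \<le> m" "m + d = Suc j" using 3 by (auto simp: m_def)
    have mono: "a (m + 3) \<le> a (m + 3 + k)" if "m + 3 + k \<le> j" for k
      using that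
    proof (induction k)
      case (Suc k)
      then show ?case using less.IH[of "m + 3 + k"] by simp
    qed simp
    have "a (m + 3) \<le> a j"
      using mono[of "j - (m + 3)"] m d by simp
    moreover have "3 * a m \<le> 2 * a (m + 1)" "3 * a (m + 1) \<le> 2 * a (m + 2)"
      "3 * a (m + 2) \<le> 2 * a (m + 3)"
      using less.IH[of m] less.IH[of "m + 1"] less.IH[of "m + 2"] m d by (simp_all add: numeral_eq_Suc)
    moreover have "4 * a j \<le> 2 * a (Suc j) + 3 * a m"
      using above[OF m(1)] m(2) by simp
    ultimately show ?thesis by linarith
  qed
qed

lemma exponential_growth_of_ratio:
  assumes "component_dim F 0 = 1" "\<And>j. 3 * component_dim F j \<le> 2 * component_dim F (Suc j)"
  shows "exponential_growth (growth F)"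
proof -
  have dim: "(3/2) ^ j \<le> real (component_dim F j)" for j
  proof (induction j)
    case (Suc j)
    have "3 * real (component_dim F j) \<le> 2 * real (component_dim F (Suc j))"
      using assms(2)[of j] by linarith
    then show ?case using Suc by simp
  qed (simp add: assms)
  have "1 * (3/2) ^ m \<le> real (growth F m)" for m
  proof -
    have "component_dim F m \<le> growth F m"
      unfolding growth_def by (rule member_le_sum) auto
    then show ?thesis using dim[of m] by linarith
  qed
  then show ?thesis
    unfolding exponential_growth_def by (intro exI[of _ 1] exI[of _ "3/2"]) auto
qed

lemma exponential_growth_degree_ge_5:
  assumes "5 \<le> n" "F \<in> homogeneous n" "potential F"
  shows "exponential_growth (growth F)"
proof -
  interpret homogeneous_potential F n
    using assms by unfold_locales auto
  have "3 * component_dim F j \<le> 2 * component_dim F (Suc j)" for j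
  proof (rule growth_ratio[of "n - 1"])
    show "4 * component_dim F (m + (n - 1) - 1) \<le> 2 * component_dim F (m + (n - 1)) + 3 * component_dim F m"
      if "1 \<le> m" for m
      using component_dim_recurrence[OF that] assms(1) by (simp add: numeral_eq_Suc)
  qed (use assms(1) component_dim_below component_dim_degree in auto)
  moreover have "component_dim F 0 = 1"
    using component_dim_below[of 0] assms(1) by simp
  ultimately show ?thesis by (intro exponential_growth_of_ratio)
qed

section \<open>A potential of degree 4 with polynomial growth\<close>

text \<open>
  The cyclic orbit of \<open>x\<^sup>2 y\<^sup>2\<close> minus twice that of \<open>x y x y\<close>. The coefficient \<open>- 2\<close> turns the derivatives
  into double commutators; in characteristic 2 those terms vanish and so do the corresponding terms
  of the double commutators, so that the same potential serves every field.
\<close>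

definition heisenberg_potential :: "'k::field freealg"
  where "heisenberg_potential =
    monomial [Lx, Lx, Ly, Ly] + monomial [Lx, Ly, Ly, Lx] + monomial [Ly, Ly, Lx, Lx]
    + monomial [Ly, Lx, Lx, Ly]
    + Poly_Mapping.single [Lx, Ly, Lx, Ly] (- 2) + Poly_Mapping.single [Ly, Lx, Ly, Lx] (- 2)"

abbreviation "gen_x \<equiv> monomial [Lx]"
abbreviation "gen_y \<equiv> monomial [Ly]"

definition commutator_xy :: "'k::field freealg"
  where "commutator_xy = gen_x * gen_y - gen_y * gen_x"

text \<open>The basis monomials of Poincare, Birkhoff and Witt for the order \<open>y < x < z\<close>.\<close>

definition pbw :: "nat \<Rightarrow> nat \<Rightarrow> nat \<Rightarrow> 'k::field freealg"
  where "pbw a c b = gen_y ^ a * gen_x ^ c * commutator_xy ^ b"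

lemma heisenberg_potential_homogeneous: "heisenberg_potential \<in> homogeneous 4"
  unfolding heisenberg_potential_def
  by (auto simp: homogeneous_iff lookup_add lookup_single when_def)

lemma potential_heisenberg_potential: "potential heisenberg_potential"
  unfolding potential_def heisenberg_potential_def cyclic_shift_def
  by (simp add: linear_ext_add linear_ext_single algebra_simps)

interpretation heisenberg: homogeneous_potential heisenberg_potential 4
  by unfold_locales (simp_all add: heisenberg_potential_homogeneous potential_heisenberg_potential)

abbreviation "heisenberg_ideal \<equiv> potential_ideal heisenberg_potential"

lemma pderivative_x_heisenberg:
  "pderivative Lx heisenberg_potential =
    monomial [Lx, Ly, Ly] + monomial [Ly, Ly, Lx] + Poly_Mapping.single [Ly, Lx, Ly] (- 2)"
  unfolding heisenberg_potential_def pderivative_def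
  by (simp add: linear_ext_add linear_ext_single)

lemma pderivative_y_heisenberg:
  "pderivative Ly heisenberg_potential =
    monomial [Ly, Lx, Lx] + monomial [Lx, Lx, Ly] + Poly_Mapping.single [Lx, Ly, Lx] (- 2)"
  unfolding heisenberg_potential_def pderivative_def
  by (simp add: linear_ext_add linear_ext_single)

lemma single_minus_2: "Poly_Mapping.single w (- 2 :: 'k::field) = - monomial w - monomial w"
  by (simp flip: single_uminus single_diff)

lemma commutator_central:
  "commutator_xy * gen_y - gen_y * commutator_xy \<in> heisenberg_ideal"
  "commutator_xy * gen_x - gen_x * commutator_xy \<in> heisenberg_ideal"
proof -
  have "commutator_xy * gen_y - gen_y * commutator_xy = pderivative Lx heisenberg_potential"
    by (simp add: commutator_xy_def pderivative_x_heisenberg algebra_simps monomial_mult single_minus_2)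
  then show "commutator_xy * gen_y - gen_y * commutator_xy \<in> heisenberg_ideal"
    using pderivative_in_potential_ideal by metis
  have "commutator_xy * gen_x - gen_x * commutator_xy = - pderivative Ly heisenberg_potential"
    by (simp add: commutator_xy_def pderivative_y_heisenberg algebra_simps monomial_mult single_minus_2)
  then show "commutator_xy * gen_x - gen_x * commutator_xy \<in> heisenberg_ideal"
    using pderivative_in_potential_ideal free.subspace_neg[OF subspace_potential_ideal] by metis
qed

lemma potential_ideal_cong_trans:
  "p - q \<in> potential_ideal F \<Longrightarrow> q - r \<in> potential_ideal F \<Longrightarrow> p - r \<in> potential_ideal F"
  using free.subspace_add[OF subspace_potential_ideal, of "p - q" F "q - r"] by simp

lemma potential_ideal_cong_mult:
  assumes "p - q \<in> potential_ideal F"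
  shows "r * p - r * q \<in> potential_ideal F" "p * r - q * r \<in> potential_ideal F"
  using potential_ideal_mult[OF assms, of r] by (simp_all add: algebra_simps)

lemma commute_power_mod:
  assumes "z * p - p * z \<in> potential_ideal F"
  shows "z * p ^ k - p ^ k * z \<in> potential_ideal F"
proof (induction k)
  case 0
  show ?case using free.subspace_0[OF subspace_potential_ideal] by simp
next
  case (Suc k)
  show ?case
  proof (rule potential_ideal_cong_trans)
    show "z * p ^ Suc k - p * (z * p ^ k) \<in> potential_ideal F"
      using potential_ideal_cong_mult(2)[OF assms, of "p ^ k"] by (simp add: mult.assoc)
    show "p * (z * p ^ k) - p ^ Suc k * z \<in> potential_ideal F"
      using potential_ideal_cong_mult(1)[OF Suc, of p] by (simp add: mult.assoc)
  qed
qed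

text \<open>
  The commutation rule \<open>x y\<^sup>a = y\<^sup>a x + a y\<^sup>a\<^sup>-\<^sup>1 z\<close> of the Weyl algebra, valid modulo the ideal since \<open>z\<close> is
  central there. The truncated exponent for \<open>a = 0\<close> is harmless as its coefficient is \<open>0\<close>.
\<close>

lemma x_past_y_power:
  "gen_x * gen_y ^ a - (gen_y ^ a * gen_x + of_nat a * gen_y ^ (a - 1) * commutator_xy)
    \<in> heisenberg_ideal"
proof (induction a)
  case 0
  show ?case using free.subspace_0[OF subspace_potential_ideal] by simp
next
  case (Suc a)
  have y: "gen_y * (of_nat a * gen_y ^ (a - 1)) = of_nat a * (gen_y ^ a :: 'a freealg)"
  proof -
    have "gen_y * (of_nat a * gen_y ^ (a - 1)) = of_nat a * (gen_y * gen_y ^ (a - 1) :: 'a freealg)"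
      by (metis mult.assoc mult_of_nat_commute)
    then show ?thesis by (cases a) simp_all
  qed
  have "gen_x * gen_y ^ Suc a - (gen_y ^ Suc a * gen_x + of_nat (Suc a) * gen_y ^ (Suc a - 1) * commutator_xy)
    = gen_y * (gen_x * gen_y ^ a - (gen_y ^ a * gen_x + of_nat a * gen_y ^ (a - 1) * commutator_xy))
      + (commutator_xy * gen_y ^ a - gen_y ^ a * commutator_xy) + gen_y * (of_nat a * gen_y ^ (a - 1)) * commutator_xy
      - of_nat a * gen_y ^ a * (commutator_xy :: 'a freealg)"
    by (simp add: commutator_xy_def algebra_simps)
  also have "\<dots> = gen_y * (gen_x * gen_y ^ a - (gen_y ^ a * gen_x + of_nat a * gen_y ^ (a - 1) * commutator_xy))
      + (commutator_xy * gen_y ^ a - gen_y ^ a * commutator_xy)"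
    unfolding y by simp
  also have "\<dots> \<in> heisenberg_ideal"
    by (intro free.subspace_add[OF subspace_potential_ideal] potential_ideal_mult(1) Suc
        commute_power_mod commutator_central)
  finally show ?case .
qed

lemma x_mult_pbw:
  "gen_x * pbw a c b - (pbw a (Suc c) b + of_nat a * pbw (a - 1) c (Suc b)) \<in> heisenberg_ideal"
proof -
  let ?z = commutator_xy
  have "gen_x * pbw a c b - (pbw a (Suc c) b + of_nat a * pbw (a - 1) c (Suc b))
    = (gen_x * gen_y ^ a - (gen_y ^ a * gen_x + of_nat a * gen_y ^ (a - 1) * ?z)) * (gen_x ^ c * ?z ^ b)
      + of_nat a * gen_y ^ (a - 1) * (?z * gen_x ^ c - gen_x ^ c * ?z) * ?z ^ b"
    by (simp add: pbw_def algebra_simps)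
  also have "\<dots> \<in> heisenberg_ideal"
    by (intro free.subspace_add[OF subspace_potential_ideal] potential_ideal_mult x_past_y_power
        commute_power_mod commutator_central)
  finally show ?thesis .
qed

definition pbw_set :: "nat \<Rightarrow> 'k::field freealg set"
  where "pbw_set j = {pbw a c b |a c b. a + c + 2 * b = j}"

lemma power_homogeneous: "p \<in> homogeneous i \<Longrightarrow> p ^ k \<in> homogeneous (k * i)"
proof (induction k)
  case 0
  show ?case using monomial_homogeneous[of "[]" 0] by (simp flip: zero_list_def)
next
  case (Suc k)
  then show ?case using mult_homogeneous[of p i "p ^ k" "k * i"] by simp
qed

lemma pbw_set_homogeneous: "pbw_set j \<subseteq> homogeneous j"
proof -
  have "(commutator_xy :: 'a freealg) \<in> homogeneous 2"
    unfolding commutator_xy_def monomial_mult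
    by (intro free.subspace_diff[OF subspace_homogeneous] monomial_homogeneous) simp_all
  then have "(pbw a c b :: 'a freealg) \<in> homogeneous (a * 1 + c * 1 + b * 2)" for a c b
    unfolding pbw_def by (intro mult_homogeneous power_homogeneous monomial_homogeneous) simp_all
  then show ?thesis
    unfolding pbw_set_def by (auto simp: mult.commute)
qed

lemma finite_pbw_set: "finite (pbw_set j :: 'k::field freealg set)"
  and card_pbw_set: "card (pbw_set j :: 'k freealg set) \<le> (j + 1) ^ 2"
proof -
  let ?P = "{..j} \<times> {..j}"
  have sub: "(pbw_set j :: 'k freealg set) \<subseteq> (\<lambda>(a, b). pbw a (j - a - 2 * b) b :: 'k freealg) ` ?P"
  proof
    fix p :: "'k freealg" assume "p \<in> pbw_set j"
    then obtain a c b where "p = pbw a c b" "a + c + 2 * b = j"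
      by (auto simp: pbw_set_def)
    then show "p \<in> (\<lambda>(a, b). pbw a (j - a - 2 * b) b :: 'k freealg) ` ?P"
      by (intro image_eqI[of _ _ "(a, b)"]) auto
  qed
  then show "finite (pbw_set j :: 'k freealg set)" by (rule finite_subset) simp
  have "card (pbw_set j :: 'k freealg set) \<le> card ?P"
    using card_mono[OF _ sub] card_image_le[of ?P "\<lambda>(a, b). pbw a (j - a - 2 * b) b :: 'k freealg"] by simp
  then show "card (pbw_set j :: 'k freealg set) \<le> (j + 1) ^ 2" by (simp add: power2_eq_square)
qed

text \<open>
  It suffices that the span is stable under multiplication from the left by both letters, up to
  raising the degree by one; for \<open>y\<close> this is immediate and for \<open>x\<close> it is the commutation rule.
\<close>

lemma word_in_span_pbw:
  "(monomial w :: 'k::field freealg) \<in> free.span (pbw_set (length w) \<union> heisenberg_ideal)"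
proof (induction w)
  case Nil
  have "monomial [] = (pbw 0 0 0 :: 'k freealg)" by (simp add: pbw_def flip: zero_list_def)
  then show ?case by (intro free.span_base) (auto simp: pbw_set_def)
next
  case (Cons c w)
  let ?V = "free.span (pbw_set (length (c # w)) \<union> heisenberg_ideal) :: 'k freealg set"
  have ideal: "p \<in> heisenberg_ideal \<Longrightarrow> p \<in> ?V" for p
    by (simp add: free.span_base)
  have pbw: "pbw a k b \<in> ?V" if "a + k + 2 * b = length (c # w)" for a k b
    using that by (intro free.span_base) (auto simp: pbw_set_def)
  have "monomial [c] * pbw a k b \<in> ?V" if len: "a + k + 2 * b = length w" for a k b
  proof (cases c)
    case Lx
    have "of_nat a * pbw (a - 1) k (Suc b) \<in> ?V"
    proof (cases a)
      case (Suc a')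
      have "(of_nat a :: 'k freealg) = scalar (of_nat a)"
        by (simp add: scalar_def flip: zero_list_def)
      moreover have "scalar (of_nat a) * pbw (a - 1) k (Suc b) \<in> ?V"
        using len Suc by (intro free.span_scale pbw) simp
      ultimately show ?thesis by simp
    qed (simp add: free.span_zero)
    then have "pbw a (Suc k) b + of_nat a * pbw (a - 1) k (Suc b) \<in> ?V"
      using pbw[of a "Suc k" b] len by (intro free.span_add) auto
    moreover have "gen_x * pbw a k b - (pbw a (Suc k) b + of_nat a * pbw (a - 1) k (Suc b)) \<in> ?V"
      by (rule ideal[OF x_mult_pbw])
    ultimately show ?thesis
      using free.span_add Lx by fastforce
  next
    case Ly
    have "gen_y * pbw a k b = (pbw (Suc a) k b :: 'k freealg)" by (simp add: pbw_def mult.assoc)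
    then show ?thesis using pbw[of "Suc a" k b] len Ly by simp
  qed
  then have "monomial [c] * p \<in> ?V" if "p \<in> pbw_set (length w)" for p
    using that by (auto simp: pbw_set_def[of "length w"])
  moreover have "monomial [c] * p \<in> ?V" if "p \<in> heisenberg_ideal" for p
    using that by (intro ideal potential_ideal_mult)
  ultimately have "(*) (monomial [c]) ` (pbw_set (length w) \<union> heisenberg_ideal) \<subseteq> ?V"
    by blast
  then have "monomial [c] * monomial w \<in> ?V"
    using span_mult_left[OF Cons, of "monomial [c]"] free.span_minimal[OF _ free.subspace_span] by blast
  then show ?case by (simp add: monomial_mult)
qed

lemma component_dim_heisenberg_le: "component_dim heisenberg_potential j \<le> (j + 1) ^ 2"
proof -
  have "monomial ` words j \<subseteq> free.span (pbw_set j \<union> heisenberg_ideal)"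
    using word_in_span_pbw by auto
  then have "homogeneous j \<subseteq> free.span (pbw_set j \<union> heisenberg_ideal)"
    unfolding homogeneous_eq_span by (rule free.span_minimal) (rule free.subspace_span)
  then show ?thesis
    using heisenberg.component_dim_le[OF finite_pbw_set pbw_set_homogeneous] card_pbw_set order.trans
    by blast
qed

text \<open>
  The coefficient of \<open>x\<^sup>i y\<^sup>j\<^sup>-\<^sup>i\<close> in the image of \<open>p\<close> in the commutative polynomial ring.
\<close>

definition content_sum :: "nat \<Rightarrow> nat \<Rightarrow> 'k::field freealg \<Rightarrow> 'k"
  where "content_sum i j p = (\<Sum>w | length w = j \<and> count_list w Lx = i. Poly_Mapping.lookup p w)"

lemma content_sum_add: "content_sum i j (p + q) = content_sum i j p + content_sum i j q"
  by (simp add: content_sum_def lookup_add sum.distrib)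

lemma content_sum_single:
  "content_sum i j (Poly_Mapping.single w c) = (if length w = j \<and> count_list w Lx = i then c else 0)"
proof -
  have "finite {w :: letter list. length w = j \<and> count_list w Lx = i}"
    by (rule finite_subset[OF _ finite_words[of j]]) auto
  then show ?thesis
    by (simp add: content_sum_def lookup_single when_def)
qed

lemma subspace_content_sum_zero: "free.subspace {p. content_sum i j p = 0}"
  by (rule free.subspaceI)
    (simp_all add: content_sum_def lookup_add sum.distrib flip: sum_distrib_left)

text \<open>
  The three terms of each derivative have the same letters and coefficients \<open>1\<close>, \<open>1\<close>, \<open>- 2\<close>, which
  add up to \<open>0\<close>.
\<close>

lemma content_sum_heisenberg_ideal:
  assumes "p \<in> heisenberg_ideal"
  shows "content_sum i j p = 0"
proof -
  have "content_sum i j (monomial u * pderivative z heisenberg_potential * monomial v) = 0" for u z v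
    by (cases z)
      (simp_all add: pderivative_x_heisenberg pderivative_y_heisenberg distrib_left distrib_right
        mult_single plus_list_def content_sum_add content_sum_single)
  then have "free.span (ideal_generators heisenberg_potential) \<subseteq> {p. content_sum i j p = 0}"
    by (intro free.span_minimal subspace_content_sum_zero) (auto simp: ideal_generators_def)
  then show ?thesis
    using assms by (auto simp: potential_ideal_eq_span)
qed

text \<open>
  Every one of the \<open>j + 1\<close> commutative monomials of degree \<open>j\<close> must be the image of some normal word,
  for otherwise its coefficient would vanish on the whole component of degree \<open>j\<close>.
\<close>

lemma component_dim_heisenberg_ge: "j + 1 \<le> component_dim (heisenberg_potential :: 'k::field freealg) j"
proof -
  obtain B C where B: "free.span B = heisenberg.ideal_part j" and C: "C \<subseteq> words j"
    and span: "(homogeneous j :: 'k freealg set) = free.span (B \<union> monomial ` C)"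
    and card_C: "card C = component_dim (heisenberg_potential :: 'k freealg) j"
    by (rule heisenberg.normal_words)
  have "{..j} \<subseteq> (\<lambda>w. count_list w Lx) ` C"
  proof (rule subsetI, rule ccontr)
    fix i assume i: "i \<in> {..j}" "i \<notin> (\<lambda>w. count_list w Lx) ` C"
    have "B \<subseteq> heisenberg_ideal"
      using B free.span_superset[of B] by (auto simp: heisenberg.ideal_part_def)
    then have "free.span (B \<union> monomial ` C) \<subseteq> {p. content_sum i j p = 0}"
      using i(2)
      by (intro free.span_minimal subspace_content_sum_zero)
        (auto simp: content_sum_single intro: content_sum_heisenberg_ideal)
    moreover have count: "count_list (replicate k z) Lx = (if z = Lx then k else 0)" for k z
      by (induction k) auto
    let ?w = "replicate (j - i) Ly @ replicate i Lx"
    have "length ?w = j" "count_list ?w Lx = i"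
      using i(1) by (simp_all add: count)
    then have "content_sum i j (monomial ?w :: 'k freealg) = 1"
      and "(monomial ?w :: 'k freealg) \<in> homogeneous j"
      by (simp_all add: content_sum_single monomial_homogeneous)
    ultimately show False
      using span by auto
  qed
  moreover have "finite C" by (rule finite_subset[OF C finite_words])
  ultimately have "card {..j} \<le> card C"
    by (rule surj_card_le[rotated])
  then show ?thesis by (simp add: card_C)
qed

lemma polynomial_growth_heisenberg: "polynomial_growth (growth heisenberg_potential)"
proof -
  have "real (growth heisenberg_potential m) \<le> 8 * real m ^ 3" if "1 \<le> m" for m
  proof -
    have "growth heisenberg_potential m \<le> (\<Sum>j\<le>m. (m + 1) ^ 2)"
      unfolding growth_def
      by (intro sum_mono order.trans[OF component_dim_heisenberg_le] power_mono) auto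
    also have "\<dots> = (m + 1) ^ 3"
      by (simp add: power3_eq_cube power2_eq_square)
    also have "\<dots> \<le> (2 * m) ^ 3"
      using that by (intro power_mono) auto
    also have "\<dots> = 8 * m ^ 3"
      by (simp add: power_mult_distrib)
    finally have "real (growth heisenberg_potential m) \<le> real (8 * m ^ 3)"
      by (rule of_nat_mono)
    then show ?thesis by simp
  qed
  then show ?thesis unfolding polynomial_growth_def by blast
qed

lemma at_least_quadratic_growth_heisenberg:
  "at_least_quadratic_growth (growth (heisenberg_potential :: 'k::field freealg))"
proof -
  let ?g = "growth (heisenberg_potential :: 'k freealg)"
  have "1 / 2 * real m ^ 2 \<le> real (?g m)" for m
  proof -
    have "(\<Sum>j\<le>m. j) \<le> ?g m"
      unfolding growth_def
      by (intro sum_mono order.trans[OF _ component_dim_heisenberg_ge]) simp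
    then have "real (\<Sum>j\<le>m. j) \<le> real (?g m)"
      by (rule of_nat_mono)
    moreover have "2 * (\<Sum>j\<le>m. j) = m * (m + 1)"
      by (induction m) auto
    then have "2 * real (\<Sum>j\<le>m. j) = real m * (real m + 1)"
      by (metis of_nat_mult of_nat_numeral of_nat_add of_nat_1)
    ultimately have "real m * (real m + 1) \<le> 2 * real (?g m)"
      by linarith
    moreover have "real m ^ 2 \<le> real m * (real m + 1)"
      by (simp add: power2_eq_square algebra_simps)
    ultimately show ?thesis by simp
  qed
  then show ?thesis
    unfolding at_least_quadratic_growth_def by (intro exI[of _ "1/2"]) auto
qed

theorem corollary1p3:
  shows "(\<exists>F :: 'k::field freealg. F \<in> homogeneous 4 \<and> potential F \<and>
            polynomial_growth (growth F) \<and> at_least_quadratic_growth (growth F))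
       \<and> (\<forall>(F :: 'k freealg) n. n \<ge> 5 \<and> F \<in> homogeneous n \<and> potential F \<longrightarrow>
            exponential_growth (growth F))"
  using heisenberg_potential_homogeneous potential_heisenberg_potential
    polynomial_growth_heisenberg at_least_quadratic_growth_heisenberg exponential_growth_degree_ge_5
  by blast

end
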